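(* Let $n>2$ students sit in a circle and let $c \geq 3n-2$ candies be distributed arbitrarily among them, and play the candy-passing game described in the context. Then all students' candy piles eventually stabilize: there is a round after which the number of candies held by each student never changes again.
   Context: The candy-passing game: $c>0$ candies are distributed arbitrarily among $n>2$ students sitting in a circle. At each round (each sounding of a whistle), simultaneously, every student who has two or more candies passes one candy to his left-hand neighbor and one candy to his right-hand neighbor; a student with fewer than two candies does nothing. A student's candy pile is said to have stabilized after some round if the amount of candy that student has does not change over the remainder of the game. *)

theory Defs
  imports Main
begin

(* The students are 0, ..., n - 1; a distribution a gives student i < n the number a i of
   candies, and its values at indices i \<ge> n are irrelevant. The left-hand neighbor of
   student i is i + 1 and the right-hand neighbor is i - 1, both modulo n. *)

definition left_nb :: "nat \<Rightarrow> nat \<Rightarrow> nat" where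
  "left_nb n i = (i + 1) mod n"

definition right_nb :: "nat \<Rightarrow> nat \<Rightarrow> nat" where
  "right_nb n i = (i + n - 1) mod n"

definition passes :: "(nat \<Rightarrow> nat) \<Rightarrow> nat \<Rightarrow> bool" where
  "passes a i \<longleftrightarrow> a i \<ge> 2"

(* Student i receives the candy that his right-hand neighbor passes to the left and the
   candy that his left-hand neighbor passes to the right. *)
definition candy_round :: "nat \<Rightarrow> (nat \<Rightarrow> nat) \<Rightarrow> (nat \<Rightarrow> nat)" where
  "candy_round n a = (\<lambda>i.
     (if passes a i then a i - 2 else a i)
     + (if passes a (right_nb n i) then 1 else 0)
     + (if passes a (left_nb n i) then 1 else 0))"

definition candies :: "nat \<Rightarrow> (nat \<Rightarrow> nat) \<Rightarrow> nat \<Rightarrow> (nat \<Rightarrow> nat)" where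
  "candies n a t = (candy_round n ^^ t) a"

definition stabilized_after :: "nat \<Rightarrow> (nat \<Rightarrow> nat) \<Rightarrow> nat \<Rightarrow> nat \<Rightarrow> bool" where
  "stabilized_after n a T i \<longleftrightarrow> (\<forall>t\<ge>T. candies n a t i = candies n a T i)"

end

(* A pile of more than three candies never grows, and a pile of at most three never exceeds three,
   so every max (pile, 3) eventually becomes constant. If some pile then stays above three, that
   student passes forever and keeps his pile, so both neighbors pass in every round; their piles
   are then nonincreasing, hence eventually constant, and the argument propagates around the circle.
   Otherwise all piles are at most three, and c \<ge> 3n - 2 leaves a total deficit of at most two:
   either everybody passes, or one student has one candy and all others three, in which case
   everybody passes one round later. *)

theory Submission
  imports Complex_Main Defs
begin

lemma eventually_constant_if_eventually_decreasing:
  fixes f :: "nat \<Rightarrow> nat"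
  assumes "\<forall>\<^sub>F t in sequentially. f (Suc t) \<le> f t"
  shows "\<exists>v. \<forall>\<^sub>F t in sequentially. f t = v"
proof -
  obtain T where T: "\<And>t. t \<ge> T \<Longrightarrow> f (Suc t) \<le> f t"
    using assms by (auto simp: eventually_sequentially)
  define g where "g t = f (T + t)" for t
  have mono: "g t \<le> g s" if "s \<le> t" for s t
    using that by (rule lift_Suc_antimono_le[rotated]) (simp add: g_def T)
  \<comment> \<open>From a position \<open>m\<close> of the minimum on, antitonicity leaves
    \<open>g\<close> no other value.\<close>
  obtain m where m: "\<And>t. g m \<le> g t"
    using ex_has_least_nat[of "\<lambda>_. True" 0 g] by auto
  have "f t = g m" if "t \<ge> T + m" for t
    using mono[of m "t - T"] m[of "t - T"] that by (simp add: g_def)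
  then show ?thesis
    by (auto simp: eventually_sequentially)
qed

lemma left_nb_eq: "i < n \<Longrightarrow> left_nb n i = (if Suc i = n then 0 else Suc i)"
  by (simp add: left_nb_def)

lemma right_nb_eq: "i < n \<Longrightarrow> right_nb n i = (if i = 0 then n - 1 else i - 1)"
  by (cases i) (simp_all add: right_nb_def)

lemma candies_0 [simp]: "candies n a 0 = a"
  by (simp add: candies_def)

lemma candies_Suc: "candies n a (Suc t) = candy_round n (candies n a t)"
  by (simp add: candies_def)

text \<open>With the two passed candies on the left, no truncated subtraction occurs and the
  equation can be summed over the circle.\<close>

lemma candy_round_balance:
  "candy_round n a i + 2 * of_bool (passes a i) =
     a i + of_bool (passes a (right_nb n i)) + of_bool (passes a (left_nb n i))"
  by (auto simp: candy_round_def passes_def)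

text \<open>\<open>left_nb n\<close> and \<open>right_nb n\<close> are mutually inverse permutations
  of the circle, so each neighbor sum counts every passing student once.\<close>

lemma sum_candy_round: "(\<Sum>i<n. candy_round n a i) = (\<Sum>i<n. a i)"
proof -
  let ?p = "\<lambda>i. of_bool (passes a i) :: nat"
  have left: "(\<Sum>i<n. ?p (left_nb n i)) = (\<Sum>i<n. ?p i)"
    by (rule sum.reindex_bij_witness[where i = "right_nb n" and j = "left_nb n"])
      (auto simp: left_nb_eq right_nb_eq)
  have right: "(\<Sum>i<n. ?p (right_nb n i)) = (\<Sum>i<n. ?p i)"
    by (rule sum.reindex_bij_witness[where i = "left_nb n" and j = "right_nb n"])
      (auto simp: left_nb_eq right_nb_eq)
  have "(\<Sum>i<n. candy_round n a i + 2 * ?p i) =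
      (\<Sum>i<n. a i + ?p (right_nb n i) + ?p (left_nb n i))"
    by (simp only: candy_round_balance)
  then show ?thesis
    unfolding sum.distrib left right sum_distrib_left[of 2 ?p, symmetric] by linarith
qed

lemma sum_candies: "(\<Sum>i<n. candies n a t i) = (\<Sum>i<n. a i)"
  by (induction t) (simp_all add: candies_Suc sum_candy_round)

lemma candy_round_le_if_passes: "passes a i \<Longrightarrow> candy_round n a i \<le> a i"
  by (auto simp: candy_round_def passes_def)

text \<open>The bound 3 comes from a pile of one candy, which gives nothing and can gain
  two.\<close>

lemma max_candy_round_le: "max (candy_round n a i) 3 \<le> max (a i) 3"
  by (auto simp: candy_round_def passes_def)

text \<open>Two candies leave the pile, so it keeps its size only if a candy arrives from each
  side.\<close>

lemma left_nb_passes_if_constant: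
  "passes a i \<Longrightarrow> candy_round n a i = a i \<Longrightarrow> passes a (left_nb n i)"
  by (auto simp: candy_round_def passes_def split: if_splits)

lemma eventually_max_constant:
  "\<exists>v. \<forall>\<^sub>F t in sequentially. max (candies n a t i) 3 = v"
  by (rule eventually_constant_if_eventually_decreasing)
    (simp only: candies_Suc max_candy_round_le eventually_True)

definition eventually_passes :: "nat \<Rightarrow> (nat \<Rightarrow> nat) \<Rightarrow> nat \<Rightarrow> bool" where
  "eventually_passes n a i \<longleftrightarrow> (\<forall>\<^sub>F t in sequentially. passes (candies n a t) i)"

lemma eventually_passes_constant:
  assumes "eventually_passes n a i"
  shows "\<exists>v. \<forall>\<^sub>F t in sequentially. candies n a t i = v"
  by (rule eventually_constant_if_eventually_decreasing,
      rule eventually_mono[OF assms[unfolded eventually_passes_def]])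
    (simp add: candies_Suc candy_round_le_if_passes)

lemma eventually_passes_left_nb:
  assumes "eventually_passes n a i"
  shows "eventually_passes n a (left_nb n i)"
proof -
  obtain v where v: "\<forall>\<^sub>F t in sequentially. candies n a t i = v"
    using eventually_passes_constant[OF assms] by blast
  \<comment> \<open>The shift provides the value \<open>v\<close> both before and after the same
    late round.\<close>
  have "\<forall>\<^sub>F t in sequentially. candies n a (Suc t) i = v"
    using v eventually_sequentially_Suc[of "\<lambda>t. candies n a t i = v"] by blast
  with v assms[unfolded eventually_passes_def] show ?thesis
    unfolding eventually_passes_def
    by eventually_elim (auto simp: candies_Suc intro: left_nb_passes_if_constant)
qed

lemma eventually_passes_all:
  assumes "eventually_passes n a i" and "j < n"
  shows "eventually_passes n a j"
proof -
  \<comment> \<open>The index \<open>i\<close> may lie outside the circle; only a step to the left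
    reduces it modulo \<open>n\<close>, hence the start at \<open>k = 1\<close>.\<close>
  have *: "eventually_passes n a ((i + k) mod n)" if "k > 0" for k
    using that
  proof (induction k rule: nat_induct_non_zero)
    case 1
    show ?case
      using eventually_passes_left_nb[OF assms(1)] by (simp add: left_nb_def)
  next
    case (Suc k)
    show ?case
      using eventually_passes_left_nb[OF Suc.IH] by (simp add: left_nb_def mod_Suc_eq)
  qed
  \<comment> \<open>The number of steps is \<open>j - i\<close> modulo \<open>n\<close>; adding the
    multiple \<open>n * Suc i\<close> makes it positive and the subtraction exact.\<close>
  have "Suc i \<le> n * Suc i"
    using assms(2) by (cases n) auto
  then have pos: "n * Suc i + j - i > 0" and sum: "i + (n * Suc i + j - i) = n * Suc i + j"
    by linarith+
  have "(n * Suc i + j) mod n = j"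
    using assms(2) by (simp only: mod_mult_self4 mod_less)
  with *[OF pos] show ?thesis
    by (simp only: sum)
qed

lemma all_pass_candy_round:
  assumes "\<And>i. i < n \<Longrightarrow> passes a i" and "i < n"
  shows "candy_round n a i = a i"
proof -
  have "left_nb n i < n" "right_nb n i < n"
    using assms(2) by (simp_all add: left_nb_def right_nb_def)
  then show ?thesis
    using assms(1)[of "left_nb n i"] assms(1)[of "right_nb n i"] assms(1)[OF assms(2)]
    by (simp add: candy_round_def passes_def)
qed

lemma all_pass_eventually_passes:
  assumes "\<And>i. i < n \<Longrightarrow> passes (candies n a T) i" and "i < n"
  shows "eventually_passes n a i"
proof -
  have const: "\<forall>i<n. candies n a t i = candies n a T i" if "t \<ge> T" for t
    using that
  proof (induction t rule: dec_induct)
    case (step t)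
    then have "passes (candies n a t) i" if "i < n" for i
      using assms(1)[OF that] that by (simp add: passes_def)
    with step.IH show ?case
      by (simp add: candies_Suc all_pass_candy_round)
  qed simp
  have "passes (candies n a t) i" if "t \<ge> T" for t
    using const[OF that] assms(1)[OF assms(2)] assms(2) by (simp add: passes_def)
  then show ?thesis
    unfolding eventually_passes_def eventually_sequentially by blast
qed

lemma small_piles_all_pass:
  assumes "n > 2" and "\<And>i. i < n \<Longrightarrow> a i \<le> 3" and "(\<Sum>i<n. a i) \<ge> 3 * n - 2"
  shows "(\<forall>i<n. passes a i) \<or> (\<forall>i<n. passes (candy_round n a) i)"
proof (cases "\<forall>i<n. passes a i")
  case False
  then obtain j where j: "j < n" "a j \<le> 1"
    by (auto simp: passes_def not_le)
  have "(\<Sum>i<n. (3 - a i) + a i) = (\<Sum>i<n. 3)"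
    by (rule sum.cong) (use assms(2) in auto)
  then have deficit: "(\<Sum>i<n. 3 - a i) \<le> 2"
    using assms(3) by (simp add: sum.distrib)
  have split: "(\<Sum>i<n. 3 - a i) = (3 - a j) + (\<Sum>i\<in>{..<n} - {j}. 3 - a i)"
    using j by (intro sum.remove) auto
  \<comment> \<open>A pile of at most one candy is short by at least two, which already exhausts the
    total deficit.\<close>
  have aj: "a j = 1"
    using deficit split j by linarith
  have "(\<Sum>i\<in>{..<n} - {j}. 3 - a i) = 0"
    using deficit split aj by linarith
  then have a3: "a i = 3" if "i < n" "i \<noteq> j" for i
    using that assms(2)[of i] by (auto intro: le_antisym)
  have "passes (candy_round n a) i" if "i < n" for i
  proof -
    \<comment> \<open>As \<open>n > 2\<close>, the neighbors of \<open>i\<close> are distinct, so at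
      most one of them is \<open>j\<close>. Hence \<open>j\<close> receives two candies, and any
      other student keeps one and receives at least one.\<close>
    have lt: "left_nb n i < n" "right_nb n i < n" and
      ne: "left_nb n i \<noteq> right_nb n i" "left_nb n i \<noteq> i" "right_nb n i \<noteq> i"
      using that assms(1) by (auto simp: left_nb_eq right_nb_eq)
    show ?thesis
      using that lt ne a3[of i] a3[of "left_nb n i"] a3[of "right_nb n i"] aj
      by (cases "i = j"; cases "left_nb n i = j") (auto simp: candy_round_def passes_def)
  qed
  then show ?thesis by blast
qed blast

lemma some_eventually_passes:
  assumes "n > 2" and "(\<Sum>i<n. a i) \<ge> 3 * n - 2"
  shows "\<exists>i. eventually_passes n a i"
proof (cases "\<exists>t. \<forall>i<n. candies n a t i \<le> 3")
  case True
  then obtain t where "\<And>i. i < n \<Longrightarrow> candies n a t i \<le> 3"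
    by blast
  then have "(\<forall>i<n. passes (candies n a t) i) \<or> (\<forall>i<n. passes (candies n a (Suc t)) i)"
    using small_piles_all_pass[of n "candies n a t"] assms
    by (simp add: sum_candies candies_Suc)
  then obtain s where "\<And>i. i < n \<Longrightarrow> passes (candies n a s) i"
    by blast
  then have "eventually_passes n a 0"
    using assms(1) by (intro all_pass_eventually_passes) auto
  then show ?thesis ..
next
  case False
  \<comment> \<open>Otherwise, the students being finitely many, all piles would be at most three at
    a common time.\<close>
  have "\<exists>i<n. \<not> (\<forall>\<^sub>F t in sequentially. candies n a t i \<le> 3)"
  proof (rule ccontr)
    assume "\<not> ?thesis"
    then have "\<forall>\<^sub>F t in sequentially. \<forall>i\<in>{..<n}. candies n a t i \<le> 3"
      by (intro eventually_ball_finite) auto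
    with False show False
      by (auto simp: eventually_sequentially)
  qed
  then obtain i where i: "\<not> (\<forall>\<^sub>F t in sequentially. candies n a t i \<le> 3)"
    by blast
  obtain v where v: "\<forall>\<^sub>F t in sequentially. max (candies n a t i) 3 = v"
    using eventually_max_constant by blast
  \<comment> \<open>Once \<open>v > 3\<close>, the maximum is attained by the pile itself, which
    then stays at \<open>v\<close>.\<close>
  have "v > 3"
  proof (rule ccontr)
    assume "\<not> v > 3"
    then have "\<forall>\<^sub>F t in sequentially. candies n a t i \<le> 3"
      by (intro eventually_mono[OF v]) auto
    with i show False ..
  qed
  then have "eventually_passes n a i"
    unfolding eventually_passes_def
    by (intro eventually_mono[OF v]) (auto simp: passes_def max_def split: if_splits)
  then show ?thesis ..
qed

theorem theorem1:
  fixes n c :: nat and a :: "nat \<Rightarrow> nat"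
  assumes "n > 2"
    and "c \<ge> 3 * n - 2"
    and "(\<Sum>i<n. a i) = c"
  shows "\<exists>T. \<forall>i<n. stabilized_after n a T i"
proof -
  obtain j where "eventually_passes n a j"
    using some_eventually_passes assms by blast
  then have "\<forall>i\<in>{..<n}. \<exists>v. \<forall>\<^sub>F t in sequentially. candies n a t i = v"
    using eventually_passes_all eventually_passes_constant by blast
  then obtain v where "\<forall>i\<in>{..<n}. \<forall>\<^sub>F t in sequentially. candies n a t i = v i"
    by metis
  \<comment> \<open>Finitely many stabilization times have a common bound.\<close>
  then have "\<forall>\<^sub>F t in sequentially. \<forall>i\<in>{..<n}. candies n a t i = v i"
    by (intro eventually_ball_finite) auto
  then obtain T where T: "\<And>t i. t \<ge> T \<Longrightarrow> i < n \<Longrightarrow> candies n a t i = v i"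
    by (auto simp: eventually_sequentially)
  have "\<forall>i<n. stabilized_after n a T i"
    by (simp add: stabilized_after_def T)
  then show ?thesis ..
qed

end
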